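(* The following two equations form an equational basis for the variety of Boolean algebras (in the signature consisting of a binary operation $+$ and a unary operation $n$): $$(x+y)+z=y+(z+x),$$ $$n(n(x+y)+n(x+n(y)))=x.$$
   Context: Boolean algebras are regarded as algebras $(A,+,n)$, $A\neq\emptyset$, where $+$ is join and $n$ is complement. To say that a set of equations is a basis for the variety of Boolean algebras means that a (nonempty) algebra $(A,+,n)$ with one binary and one unary operation satisfies the equations (for all values of the variables) if and only if it is a Boolean algebra, i.e. $+$ and $n$ are the join and the complement of a Boolean algebra structure on $A$. *)

theory Defs
  imports Main
begin

text \<open>
  An algebra \<open>(A, +, n)\<close> is given by two operations on a type, the type playing the role of the
  (nonempty, otherwise arbitrary) set \<open>A\<close>. It is a Boolean algebra if \<open>+\<close> and \<open>n\<close> are the join and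
  the complement of some Boolean algebra structure on \<open>A\<close>; the meet, the least element and the
  greatest element are not part of the signature and hence existentially quantified.
  The locale does not require the two constants to differ, so the one-element algebra is included.
\<close>

definition is_Boolean_algebra :: "('a \<Rightarrow> 'a \<Rightarrow> 'a) \<Rightarrow> ('a \<Rightarrow> 'a) \<Rightarrow> bool" where
  "is_Boolean_algebra join n \<longleftrightarrow>
     (\<exists>meet bot top. abstract_boolean_algebra meet join n bot top)"

end

theory Submission
  imports Defs
begin

text \<open>
  The second equation is Robbins' axiom. The first one alone makes sums of at least five terms
  symmetric, and Robbins' axiom then forces commutativity and associativity outright, so the claim
  reduces to the theorem that Robbins algebras are Boolean. That follows McCune and Winker: with
  \<open>u = n (x + n (3x))\<close> one has \<open>2x + u = 2x\<close>, and any absorption \<open>c + d = c\<close> makes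
  \<open>n (c + n c)\<close> a neutral element. With a neutral element, \<open>n\<close> is an involution and the
  distributive law comes from Huntington's splitting of \<open>x\<close> along \<open>y\<close> and \<open>n y\<close>.
\<close>

section \<open>Robbins algebras: cancellation, absorption, neutral element, involution\<close>

locale robbins_algebra = abel_semigroup add
  for add :: "'a \<Rightarrow> 'a \<Rightarrow> 'a" (infixl "\<^bold>+" 65) +
  fixes n :: "'a \<Rightarrow> 'a"
  assumes robbins: "n (n (x \<^bold>+ y) \<^bold>+ n (x \<^bold>+ n y)) = x"
begin

lemmas ac = assoc commute left_commute

lemma robbins_subst:
  assumes "n y = z"
  shows "n (n (x \<^bold>+ y) \<^bold>+ n (x \<^bold>+ z)) = x"
  using robbins[of x y] assms by simp

text \<open>Robbins' axiom rebuilds \<open>x\<close> and \<open>y\<close> from the same pair of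
  terms: \<open>n (x + y + z)\<close> is common to both, and the other terms agree by
  assumption.\<close>

lemma winker_cancel:
  assumes "n (x \<^bold>+ n (y \<^bold>+ z)) = n (y \<^bold>+ n (x \<^bold>+ z))"
  shows "x = y"
proof -
  have "x = n (n (x \<^bold>+ (y \<^bold>+ z)) \<^bold>+ n (x \<^bold>+ n (y \<^bold>+ z)))"
    by (simp only: robbins)
  also have "\<dots> = n (n (y \<^bold>+ (x \<^bold>+ z)) \<^bold>+ n (y \<^bold>+ n (x \<^bold>+ z)))"
    by (simp only: assms left_commute)
  also have "\<dots> = y"
    by (simp only: robbins)
  finally show ?thesis .
qed

text \<open>This is Robbins' axiom at \<open>n (x + n y)\<close> and \<open>x + y\<close>: its
  second inner term \<open>n (n (x + n y) + n (x + y))\<close> is \<open>x\<close>, again by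
  Robbins.\<close>

lemma winker_absorb: "n (x \<^bold>+ n (x \<^bold>+ y \<^bold>+ n (x \<^bold>+ n y))) = n (x \<^bold>+ n y)"
proof -
  have "n (n (x \<^bold>+ n y) \<^bold>+ n (x \<^bold>+ y)) = x"
    using robbins[of x y] by (simp add: ac)
  from robbins_subst[OF this] robbins[of "n (x \<^bold>+ n y)" "x \<^bold>+ y"] this
  show ?thesis
    by (simp add: ac)
qed

lemma double_absorbs: "x \<^bold>+ x \<^bold>+ n (x \<^bold>+ n (x \<^bold>+ x \<^bold>+ x)) = x \<^bold>+ x"
proof -
  define t where "t = x \<^bold>+ x \<^bold>+ x"
  define u where "u = n (x \<^bold>+ n t)"
  \<comment> \<open>The aim is \<open>v = n t\<close>: Robbins' axiom then expresses 2x and u + 2x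
    by one and the same negation.\<close>
  define v where "v = n (u \<^bold>+ t \<^bold>+ x \<^bold>+ x)"
  have a: "n (x \<^bold>+ n (u \<^bold>+ t \<^bold>+ x)) = u"
    using winker_absorb[of x t] by (simp add: u_def ac)
  have b: "n (u \<^bold>+ v) = x"
    using robbins[of x "u \<^bold>+ t \<^bold>+ x"] a by (simp add: v_def ac)
  have c: "n (n (z \<^bold>+ u \<^bold>+ v) \<^bold>+ n (z \<^bold>+ x)) = z" for z
    using robbins_subst[OF b, of z] by (simp add: ac)
  have d: "n (x \<^bold>+ x \<^bold>+ n (x \<^bold>+ x \<^bold>+ n t \<^bold>+ u \<^bold>+ v)) = n t"
    using robbins[of "n t" "x \<^bold>+ x \<^bold>+ u \<^bold>+ v"] c[of "x \<^bold>+ x"] by (simp add: t_def ac)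
  have e: "n (u \<^bold>+ x \<^bold>+ x \<^bold>+ n (u \<^bold>+ x \<^bold>+ x \<^bold>+ n t \<^bold>+ v)) = v"
    using robbins[of v "u \<^bold>+ x \<^bold>+ x \<^bold>+ n t"] robbins[of "u \<^bold>+ x \<^bold>+ x" t]
    by (simp add: v_def ac)
  \<comment> \<open>By \<open>d\<close>, \<open>n t\<close> is the negation of a sum, so Robbins'
    axiom for \<open>u\<close> applies to that sum; \<open>e\<close> evaluates the other inner term
    to \<open>v\<close>.\<close>
  have f: "n (v \<^bold>+ n (u \<^bold>+ n t)) = u"
    using robbins_subst[OF d, of u] e by (simp add: ac)
  have "n (u \<^bold>+ n (n t \<^bold>+ u \<^bold>+ v)) = v"
    using robbins[of v "u \<^bold>+ n t"] f by (simp add: ac)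
  moreover have "n (u \<^bold>+ n (n t \<^bold>+ u \<^bold>+ v)) = n t"
    using c[of "n t"] by (simp add: u_def ac)
  ultimately have v: "v = n t"
    by simp
  have "u \<^bold>+ x \<^bold>+ x = n (n t \<^bold>+ n (u \<^bold>+ x \<^bold>+ x \<^bold>+ n t))"
    using robbins[of "u \<^bold>+ x \<^bold>+ x" t] v by (simp add: v_def ac)
  also have "\<dots> = x \<^bold>+ x"
    using c[of "x \<^bold>+ x"] by (simp add: v t_def ac)
  finally show ?thesis
    by (simp add: u_def t_def ac)
qed

text \<open>For \<open>f = n (c + n c)\<close>, two cancellations lead to \<open>d + f = d\<close>.
  Hence \<open>c\<close> absorbs \<open>f\<close>, and \<open>f\<close> drops out of Robbins'
  formula for \<open>x + f\<close>.\<close>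

lemma absorb_neutral:
  assumes cd: "c \<^bold>+ d = c"
  shows "x \<^bold>+ n (c \<^bold>+ n c) = x"
proof -
  have cd': "c \<^bold>+ (d \<^bold>+ z) = c \<^bold>+ z" for z
    by (simp add: cd flip: assoc)
  define e where "e = n (d \<^bold>+ n c)"
  define f where "f = n (c \<^bold>+ n c)"
  have e1: "n (e \<^bold>+ n c) = d"
    using robbins[of d c] cd by (simp add: e_def ac)
  have e2: "n (d \<^bold>+ n (c \<^bold>+ e)) = e"
    using winker_absorb[of d c] cd by (simp add: e_def ac cd')
  have e3: "n (e \<^bold>+ n (c \<^bold>+ e)) = d"
    using robbins[of d "c \<^bold>+ e"] e2 by (simp add: ac cd')
  have ce: "n (c \<^bold>+ e) = n c"
    by (rule winker_cancel[of _ _ d]) (use e1 e2 e3 in \<open>simp add: ac flip: e_def\<close>)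
  have f1: "n (f \<^bold>+ n c) = c"
    using robbins[of c "d \<^bold>+ n c"] ce by (simp add: e_def f_def ac cd')
  have f2: "n (f \<^bold>+ n (c \<^bold>+ c \<^bold>+ f)) = c"
    using winker_absorb[of f c] f1 by (simp add: ac)
  have f3: "n (c \<^bold>+ n (c \<^bold>+ c \<^bold>+ f)) = f"
    using winker_absorb[of c c] by (simp add: f_def ac)
  have ccf: "n (c \<^bold>+ c \<^bold>+ f) = n c"
    by (rule winker_cancel[of _ _ c]) (use f1 f2 f3 in \<open>simp add: ac flip: f_def\<close>)
  \<comment> \<open>Robbins' axiom represents \<open>d\<close> and \<open>d + f\<close> by the same
    term, since \<open>c + c + f\<close> and \<open>c\<close> have equal negations.\<close>
  have "n (n (d \<^bold>+ n (c \<^bold>+ c) \<^bold>+ f) \<^bold>+ n c) = d"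
    using robbins_subst[OF robbins, of d c c] cd by (simp add: f_def ac)
  moreover have "n (n (d \<^bold>+ n (c \<^bold>+ c) \<^bold>+ f) \<^bold>+ n c) = d \<^bold>+ f"
    using robbins[of "d \<^bold>+ f" "c \<^bold>+ c"] ccf by (simp add: ac cd')
  ultimately have "c \<^bold>+ f = c"
    using cd'[of f] cd by simp
  then have cf': "c \<^bold>+ (f \<^bold>+ z) = c \<^bold>+ z" for z
    by (simp flip: assoc)
  have "x \<^bold>+ f = n (n (x \<^bold>+ f \<^bold>+ c) \<^bold>+ n (x \<^bold>+ f \<^bold>+ n c))"
    by (simp add: robbins)
  also have "\<dots> = n (n (x \<^bold>+ (f \<^bold>+ n c)) \<^bold>+ n (x \<^bold>+ c))"
    by (simp add: ac cf')
  also have "\<dots> = x"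
    by (rule robbins_subst[OF f1])
  finally show ?thesis
    by (simp add: f_def)
qed

lemma neutral_exists:
  obtains z where "\<And>x. x \<^bold>+ z = x" and "\<And>x. n (x \<^bold>+ n x) = z"
proof -
  obtain z where z: "\<And>x. x \<^bold>+ z = x"
    using absorb_neutral[OF double_absorbs] by blast
  then have z': "z \<^bold>+ x = x" for x
    by (simp add: commute[of z])
  have "n (n x \<^bold>+ n (n x)) = z" for x
    using robbins[of z x] by (simp add: z')
  \<comment> \<open>Robbins' axiom makes \<open>n\<close> surjective, so the law passes from
    \<open>n x\<close> to every element.\<close>
  from this[of "n (x \<^bold>+ y) \<^bold>+ n (x \<^bold>+ n y)" for x y] have "n (x \<^bold>+ n x) = z" for x
    by (simp add: robbins)
  with z show thesis
    by (rule that)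
qed

text \<open>Robbins' axiom evaluates \<open>n (n (x + x + x))\<close> in two ways, as
  \<open>x\<close> and as \<open>x + x\<close>.\<close>

lemma idem: "x \<^bold>+ x = x"
  and double_neg: "n (n x) = x"
proof -
  obtain z where z: "\<And>x. x \<^bold>+ z = x" and top: "\<And>x. n (x \<^bold>+ n x) = z"
    using neutral_exists by blast
  have z': "z \<^bold>+ x = x" for x
    using z[of x] by (simp add: commute)
  have a: "n (n (x \<^bold>+ x)) = x" for x
    using robbins[of x x] by (simp add: top z)
  have b: "n (n (x \<^bold>+ n (n x))) = x" for x
    using robbins[of x "n x"] by (simp add: top z')
  have "n (x \<^bold>+ n (x \<^bold>+ x)) = z" for x
    using top[of "n (x \<^bold>+ x)"] by (simp add: a commute)
  then have c: "n (n (x \<^bold>+ (x \<^bold>+ x))) = x" for x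
    using robbins[of x "x \<^bold>+ x"] by (simp add: z)
  show idem: "x \<^bold>+ x = x" for x
    using b[of "x \<^bold>+ x"] by (simp add: a c assoc)
  show "n (n x) = x"
    using a[of x] by (simp add: idem)
qed

section \<open>Meets, absorption and distributivity\<close>

definition meet :: "'a \<Rightarrow> 'a \<Rightarrow> 'a" (infixl "\<^bold>\<sqinter>" 70)
  where "x \<^bold>\<sqinter> y = n (n x \<^bold>+ n y)"

lemma de_Morgan: "n (x \<^bold>+ y) = n x \<^bold>\<sqinter> n y" "n (x \<^bold>\<sqinter> y) = n x \<^bold>+ n y"
  by (simp_all add: meet_def double_neg)

lemma meet_commute: "x \<^bold>\<sqinter> y = y \<^bold>\<sqinter> x"
  by (simp add: meet_def commute)

lemma meet_assoc: "(x \<^bold>\<sqinter> y) \<^bold>\<sqinter> z = x \<^bold>\<sqinter> (y \<^bold>\<sqinter> z)"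
  by (simp add: meet_def double_neg assoc)

text \<open>Negating Robbins' axiom at \<open>n x\<close> yields Huntington's equation.\<close>

lemma meet_split: "x \<^bold>\<sqinter> y \<^bold>+ x \<^bold>\<sqinter> n y = x"
  using arg_cong[OF robbins[of "n x" y], of n] by (simp add: meet_def double_neg commute)

lemma join_meet_absorb: "x \<^bold>+ x \<^bold>\<sqinter> y = x"
proof -
  have "x \<^bold>+ x \<^bold>\<sqinter> y = (x \<^bold>\<sqinter> y \<^bold>+ x \<^bold>\<sqinter> n y) \<^bold>+ x \<^bold>\<sqinter> y"
    by (simp only: meet_split)
  also have "\<dots> = (x \<^bold>\<sqinter> y \<^bold>+ x \<^bold>\<sqinter> y) \<^bold>+ x \<^bold>\<sqinter> n y"
    by (simp only: ac)
  also have "\<dots> = x"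
    by (simp only: idem meet_split)
  finally show ?thesis .
qed

lemma meet_join_absorb: "x \<^bold>\<sqinter> (x \<^bold>+ y) = x"
  using arg_cong[OF join_meet_absorb[of "n x" "n y"], of n] by (simp add: de_Morgan double_neg)

text \<open>Split \<open>y\<close> along \<open>x\<close>: the part outside \<open>x\<close> is
  absorbed by \<open>n x\<close>.\<close>

lemma compl_join_meet: "n x \<^bold>+ x \<^bold>\<sqinter> y = n x \<^bold>+ y"
proof -
  have "n x \<^bold>+ y = n x \<^bold>+ (y \<^bold>\<sqinter> x \<^bold>+ y \<^bold>\<sqinter> n x)"
    by (simp only: meet_split)
  also have "\<dots> = (n x \<^bold>+ n x \<^bold>\<sqinter> y) \<^bold>+ x \<^bold>\<sqinter> y"
    by (simp add: ac meet_commute)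
  finally show ?thesis
    by (simp only: join_meet_absorb)
qed

lemma meet_compl_join: "x \<^bold>\<sqinter> (n x \<^bold>+ y) = x \<^bold>\<sqinter> y"
  using arg_cong[OF compl_join_meet[of x "n y"], of n] by (simp add: de_Morgan double_neg)

text \<open>Both sides have the same join with \<open>n x\<close>, and by
  \<open>meet_compl_join\<close> that join determines the meet with \<open>x\<close>. The right-hand
  side lies below \<open>x\<close>, so its meet with \<open>x\<close> is itself.\<close>

lemma meet_join_distrib: "x \<^bold>\<sqinter> (y \<^bold>+ z) = x \<^bold>\<sqinter> y \<^bold>+ x \<^bold>\<sqinter> z"
proof -
  let ?w = "x \<^bold>\<sqinter> y \<^bold>+ x \<^bold>\<sqinter> z"
  have "n x \<^bold>+ (y \<^bold>+ z) = (n x \<^bold>+ x \<^bold>\<sqinter> y) \<^bold>+ z"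
    by (simp only: compl_join_meet assoc)
  also have "\<dots> = x \<^bold>\<sqinter> y \<^bold>+ (n x \<^bold>+ x \<^bold>\<sqinter> z)"
    by (simp only: compl_join_meet ac)
  also have "\<dots> = n x \<^bold>+ ?w"
    by (simp only: ac)
  finally have "x \<^bold>\<sqinter> (y \<^bold>+ z) = x \<^bold>\<sqinter> ?w"
    using meet_compl_join[of x "y \<^bold>+ z"] meet_compl_join[of x ?w] by simp
  moreover have "?w \<^bold>+ x = x"
    by (simp only: commute[of _ x] join_meet_absorb flip: assoc)
  then have "x \<^bold>\<sqinter> ?w = ?w"
    using meet_join_absorb[of ?w x] by (simp only: meet_commute)
  ultimately show ?thesis
    by simp
qed

lemma join_meet_distrib: "x \<^bold>+ y \<^bold>\<sqinter> z = (x \<^bold>+ y) \<^bold>\<sqinter> (x \<^bold>+ z)"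
  using arg_cong[OF meet_join_distrib[of "n x" "n y" "n z"], of n]
  by (simp add: de_Morgan double_neg)

lemma is_Boolean_algebra: "is_Boolean_algebra add n"
proof -
  obtain z where z: "\<And>x. x \<^bold>+ z = x" and top: "\<And>x. n (x \<^bold>+ n x) = z"
    using neutral_exists by blast
  have "abstract_boolean_algebra meet add n z (n z)"
  proof
    fix x
    show "x \<^bold>\<sqinter> n z = x"
      using z[of "n x"] by (simp add: meet_def double_neg)
    show "x \<^bold>\<sqinter> n x = z"
      using top[of "n x"] by (simp add: meet_def double_neg)
    show "x \<^bold>+ n x = n z"
      by (simp add: double_neg flip: top[of x])
  qed (rule meet_assoc meet_commute meet_join_distrib join_meet_distrib z)+
  then show ?thesis
    unfolding is_Boolean_algebra_def by blast
qed

end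

text \<open>
  All \<open>k\<close>-fold sums with \<open>k \<ge> 5\<close> are symmetric. The Robbins equation recovers \<open>x\<close> from the sums
  \<open>x + y\<close>, so the symmetry descends to shorter sums, one summand at a time.
\<close>

lemma cyclic_robbins_commute:
  fixes add :: "'a \<Rightarrow> 'a \<Rightarrow> 'a" (infixl "\<^bold>+" 65)
    and n :: "'a \<Rightarrow> 'a"
  assumes cyclic: "\<And>x y z. (x \<^bold>+ y) \<^bold>+ z = y \<^bold>+ (z \<^bold>+ x)"
    and robbins: "\<And>x y. n (n (x \<^bold>+ y) \<^bold>+ n (x \<^bold>+ n y)) = x"
  shows "x \<^bold>+ y = y \<^bold>+ x"
proof -
  have faithful: "x = y" if "\<And>z. x \<^bold>+ z = y \<^bold>+ z" for x y
    using that by (metis robbins)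
  have four: "a \<^bold>+ (b \<^bold>+ (c \<^bold>+ d)) = c \<^bold>+ (d \<^bold>+ (a \<^bold>+ b))" for a b c d
    by (rule trans[OF cyclic[symmetric]]) (simp only: cyclic)
  have pairs: "(a \<^bold>+ b) \<^bold>+ (c \<^bold>+ d) = a \<^bold>+ (c \<^bold>+ (b \<^bold>+ d))" for a b c d
  proof -
    have "(a \<^bold>+ b) \<^bold>+ (c \<^bold>+ d) = b \<^bold>+ (d \<^bold>+ (a \<^bold>+ c))"
      by (simp only: cyclic)
    also have "\<dots> = a \<^bold>+ (c \<^bold>+ (b \<^bold>+ d))"
      by (rule four)
    finally show ?thesis .
  qed
  have five1: "a \<^bold>+ (b \<^bold>+ (c \<^bold>+ (d \<^bold>+ e))) = a \<^bold>+ (d \<^bold>+ (e \<^bold>+ (b \<^bold>+ c)))" for a b c d e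
    by (simp only: four[of b])
  have five2: "a \<^bold>+ (b \<^bold>+ (c \<^bold>+ (d \<^bold>+ e))) = c \<^bold>+ (d \<^bold>+ (a \<^bold>+ (e \<^bold>+ b)))" for a b c d e
  proof -
    have "a \<^bold>+ (b \<^bold>+ (c \<^bold>+ (d \<^bold>+ e))) = c \<^bold>+ ((d \<^bold>+ e) \<^bold>+ (a \<^bold>+ b))"
      by (rule four)
    also have "\<dots> = c \<^bold>+ (d \<^bold>+ (a \<^bold>+ (e \<^bold>+ b)))"
      by (simp only: pairs)
    finally show ?thesis .
  qed
  \<comment> \<open>\<open>five2\<close> exchanges \<open>a\<close> with \<open>c\<close> and moves
    \<open>b\<close>, \<open>d\<close>, \<open>e\<close> in a 3-cycle, so its cube is a
    transposition.\<close>
  have swap: "a \<^bold>+ (b \<^bold>+ (c \<^bold>+ (d \<^bold>+ e))) = c \<^bold>+ (b \<^bold>+ (a \<^bold>+ (d \<^bold>+ e)))" for a b c d e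
    by (rule trans[OF five2 trans[OF five2 five2]])
  have normal: "a \<^bold>+ b \<^bold>+ c \<^bold>+ d \<^bold>+ e = d \<^bold>+ (e \<^bold>+ (b \<^bold>+ (c \<^bold>+ a)))" for a b c d e
  proof -
    have "a \<^bold>+ b \<^bold>+ c \<^bold>+ d \<^bold>+ e = (c \<^bold>+ (d \<^bold>+ (a \<^bold>+ b))) \<^bold>+ e"
      by (simp only: cyclic[of "a \<^bold>+ b" c d])
    also have "\<dots> = (d \<^bold>+ (a \<^bold>+ b)) \<^bold>+ (e \<^bold>+ c)"
      by (rule cyclic)
    also have "\<dots> = d \<^bold>+ (e \<^bold>+ ((a \<^bold>+ b) \<^bold>+ c))"
      by (rule pairs)
    finally show ?thesis
      by (simp only: cyclic[of a b c])
  qed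
  \<comment> \<open>By \<open>normal\<close>, \<open>b\<close> and \<open>a\<close> stand in places
    3 and 5. Conjugating \<open>swap\<close> (places 1 and 3) by \<open>five1\<close> exchanges
    places 1 and 5; conjugating the result by \<open>swap\<close> exchanges 3 and 5.\<close>
  have five: "a \<^bold>+ b \<^bold>+ c \<^bold>+ d \<^bold>+ e = b \<^bold>+ a \<^bold>+ c \<^bold>+ d \<^bold>+ e" for a b c d e
    unfolding normal
    by (rule trans[OF swap trans[OF five1 trans[OF swap trans[OF five1 swap]]]])
  show ?thesis
    \<comment> \<open>Each use of \<open>faithful\<close> appends one summand on the right, until
      five are reached.\<close>
    by (rule faithful, rule faithful, rule faithful, rule five)
qed

theorem theorem7p2:
  fixes add :: "'a \<Rightarrow> 'a \<Rightarrow> 'a" (infixl "\<^bold>+" 65)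
    and n :: "'a \<Rightarrow> 'a"
  shows "((\<forall>x y z. (x \<^bold>+ y) \<^bold>+ z = y \<^bold>+ (z \<^bold>+ x)) \<and>
          (\<forall>x y. n (n (x \<^bold>+ y) \<^bold>+ n (x \<^bold>+ n y)) = x))
         \<longleftrightarrow> is_Boolean_algebra add n"
proof (intro iffI)
  assume "(\<forall>x y z. (x \<^bold>+ y) \<^bold>+ z = y \<^bold>+ (z \<^bold>+ x)) \<and>
    (\<forall>x y. n (n (x \<^bold>+ y) \<^bold>+ n (x \<^bold>+ n y)) = x)"
  then have cyclic: "(x \<^bold>+ y) \<^bold>+ z = y \<^bold>+ (z \<^bold>+ x)"
    and robbins: "n (n (x \<^bold>+ y) \<^bold>+ n (x \<^bold>+ n y)) = x" for x y z
    by blast+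
  have comm: "x \<^bold>+ y = y \<^bold>+ x" for x y
    using cyclic robbins by (rule cyclic_robbins_commute)
  have "robbins_algebra add n"
  proof
    show "(x \<^bold>+ y) \<^bold>+ z = x \<^bold>+ (y \<^bold>+ z)" for x y z
      by (rule trans[OF cyclic trans[OF comm cyclic]])
  qed (fact comm robbins)+
  then show "is_Boolean_algebra add n"
    by (rule robbins_algebra.is_Boolean_algebra)
next
  assume "is_Boolean_algebra add n"
  then obtain meet bot top where "abstract_boolean_algebra meet add n bot top"
    unfolding is_Boolean_algebra_def by blast
  then interpret abstract_boolean_algebra meet add n bot top .
  \<comment> \<open>De Morgan gives the meet of \<open>x + y\<close> and \<open>x + n y\<close>,
    which distributivity contracts to \<open>x + bot\<close>.\<close>
  have "n (n (x \<^bold>+ y) \<^bold>+ n (x \<^bold>+ n y)) = x" for x y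
    by (simp flip: disj_conj_distrib)
  then show "(\<forall>x y z. (x \<^bold>+ y) \<^bold>+ z = y \<^bold>+ (z \<^bold>+ x)) \<and>
    (\<forall>x y. n (n (x \<^bold>+ y) \<^bold>+ n (x \<^bold>+ n y)) = x)"
    by (simp add: disj.assoc disj.commute disj.left_commute)
qed

end
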